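(* Any L-CoLT matrix $M_L\in\mathcal{C}_L^N$ can be represented by its diagonal elements $\boldsymbol{\gamma}$ and its ratio vector $\boldsymbol{r}$. Any U-CoLT matrix $M_U\in\mathcal{C}_U^N$ can be represented by its superdiagonal elements $\boldsymbol{\gamma}'$ and its ratio vector $\boldsymbol{r}'$.
   Context: The set $\mathcal{C}_L^N$ of L-CoLT (lower-collinear triangular) matrices consists of all $M=[m_{i,j}]\in\mathbb{R}^{N\times N}$ with $m_{i,j}=0$ for $i<j$ and $m_{i+1,j}/m_{i,j}=r_i$ for $j\le i$ (with $i\le N-1$), for some vector $\boldsymbol{r}\in(\mathbb{R}\setminus\{0\})^{N-1}$, called the ratio vector of $M$. The set $\mathcal{C}_U^N$ of U-CoLT (upper-collinear triangular) matrices consists of all $M=[m_{i,j}]\in\mathbb{R}^{N\times N}$ with $m_{i,j}=0$ for $i\ge j$ and $m_{i-1,j}/m_{i,j}=r'_{i-1}$ for $i<j$ (with $i\ge2$), for some vector $\boldsymbol{r}'\in(\mathbb{R}\setminus\{0\})^{N-2}$, called the ratio vector of $M$. The diagonal elements of $M_L$ form a vector $\boldsymbol{\gamma}\in\mathbb{R}^N$, and the superdiagonal elements $m_{1,2},\dots,m_{N-1,N}$ of $M_U$ form a vector $\boldsymbol{\gamma}'\in\mathbb{R}^{N-1}$. *)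

theory Defs
  imports "Jordan_Normal_Form.Matrix"
begin

(* All indices are shifted to start at 0.  Ratios are read literally: since the components of a
   ratio vector are nonzero and x / 0 = 0, a ratio condition forces its denominator to be nonzero. *)

definition L_ratio_vector :: "nat \<Rightarrow> real mat \<Rightarrow> real vec \<Rightarrow> bool" where
  "L_ratio_vector N M r \<longleftrightarrow>
     r \<in> carrier_vec (N - 1) \<and> (\<forall>i < N - 1. r $ i \<noteq> 0) \<and>
     (\<forall>i j. i + 1 < N \<and> j \<le> i \<longrightarrow> M $$ (i + 1, j) / M $$ (i, j) = r $ i)"

definition L_CoLT :: "nat \<Rightarrow> real mat set" where
  "L_CoLT N = {M \<in> carrier_mat N N.
     (\<forall>i j. i < j \<and> j < N \<longrightarrow> M $$ (i, j) = 0) \<and> (\<exists>r. L_ratio_vector N M r)}"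

(* The condition m(i-1,j) / m(i,j) = r'(i-1) for 2 <= i < j <= N in 1-based indices, with the
   row index i - 1 as the bound variable. *)
definition U_ratio_vector :: "nat \<Rightarrow> real mat \<Rightarrow> real vec \<Rightarrow> bool" where
  "U_ratio_vector N M r' \<longleftrightarrow>
     r' \<in> carrier_vec (N - 2) \<and> (\<forall>i < N - 2. r' $ i \<noteq> 0) \<and>
     (\<forall>i j. i + 1 < j \<and> j < N \<longrightarrow> M $$ (i, j) / M $$ (i + 1, j) = r' $ i)"

definition U_CoLT :: "nat \<Rightarrow> real mat set" where
  "U_CoLT N = {M \<in> carrier_mat N N.
     (\<forall>i j. j \<le> i \<and> i < N \<longrightarrow> M $$ (i, j) = 0) \<and> (\<exists>r'. U_ratio_vector N M r')}"

definition diagonal :: "nat \<Rightarrow> real mat \<Rightarrow> real vec" where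
  "diagonal N M = vec N (\<lambda>i. M $$ (i, i))"

definition superdiagonal :: "nat \<Rightarrow> real mat \<Rightarrow> real vec" where
  "superdiagonal N M = vec (N - 1) (\<lambda>i. M $$ (i, i + 1))"

(* Column j is obtained from its diagonal entry by going down row by row. *)
definition L_CoLT_mat :: "nat \<Rightarrow> real vec \<Rightarrow> real vec \<Rightarrow> real mat" where
  "L_CoLT_mat N \<gamma> r =
     mat N N (\<lambda>(i, j). if i < j then 0 else \<gamma> $ j * (\<Prod>k = j..<i. r $ k))"

(* Column j is obtained from its superdiagonal entry, in row j - 1, by going up row by row. *)
definition U_CoLT_mat :: "nat \<Rightarrow> real vec \<Rightarrow> real vec \<Rightarrow> real mat" where
  "U_CoLT_mat N \<gamma>' r' =
     mat N N (\<lambda>(i, j). if j \<le> i then 0 else \<gamma>' $ (j - 1) * (\<Prod>k = i..<j - 1. r' $ k))"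

end

theory Submission
  imports Defs
begin

text \<open>Within a column, each ratio condition is a one-step recurrence, so an entry in the
  triangle is the seed of its column times the product of the ratios passed on the way
  (\<open>L_ratio_vector_entry\<close>, \<open>U_ratio_vector_entry\<close>). The seed is the
  diagonal entry, with rows followed downwards, or the superdiagonal entry, with rows followed
  upwards. All other entries are zero by the triangular shape, so seeds and ratios fix the
  matrix.\<close>

lemma L_ratio_vector_step:
  assumes "L_ratio_vector N M r" "j \<le> i" "Suc i < N"
  shows "M $$ (Suc i, j) = M $$ (i, j) * r $ i"
proof -
  have "r $ i \<noteq> 0" "M $$ (Suc i, j) / M $$ (i, j) = r $ i"
    using assms by (auto simp: L_ratio_vector_def)
  then show ?thesis
    \<comment> \<open>A zero denominator would make the quotient 0, contradicting
      \<open>r $ i \<noteq> 0\<close>; otherwise clear the denominator.\<close>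
    by (cases "M $$ (i, j) = 0") (auto simp: field_simps)
qed

lemma U_ratio_vector_step:
  assumes "U_ratio_vector N M r" "Suc i < j" "j < N"
  shows "M $$ (i, j) = M $$ (Suc i, j) * r $ i"
proof -
  have "r $ i \<noteq> 0" "M $$ (i, j) / M $$ (Suc i, j) = r $ i"
    using assms by (auto simp: U_ratio_vector_def)
  then show ?thesis
    by (cases "M $$ (Suc i, j) = 0") (auto simp: field_simps)
qed

lemma L_ratio_vector_entry:
  assumes "L_ratio_vector N M r" "j \<le> i" "i < N"
  shows "M $$ (i, j) = M $$ (j, j) * (\<Prod>k = j..<i. r $ k)"
  using assms(2,3)
proof (induction i rule: dec_induct)
  case base
  then show ?case by simp
next
  case (step i)
  then show ?case
    using L_ratio_vector_step[OF assms(1), of j i] by (simp add: prod.atLeastLessThan_Suc)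
qed

text \<open>Writing the column as \<open>Suc j\<close> puts its superdiagonal entry in row
  \<open>j\<close> and avoids natural-number subtraction.\<close>

lemma U_ratio_vector_entry:
  assumes "U_ratio_vector N M r" "i \<le> j" "Suc j < N"
  shows "M $$ (i, Suc j) = M $$ (j, Suc j) * (\<Prod>k = i..<j. r $ k)"
  using assms(2)
\<comment> \<open>The row decreases from \<open>j\<close>, so each step adds a factor at the lower
  end of the product.\<close>
proof (induction i rule: inc_induct)
  case base
  then show ?case by simp
next
  case (step i)
  then show ?case
    using U_ratio_vector_step[OF assms(1), of i "Suc j"] assms(3)
    by (simp add: prod.atLeast_Suc_lessThan)
qed

lemma L_CoLT_eq_L_CoLT_mat:
  assumes "M \<in> L_CoLT N" "L_ratio_vector N M r"
  shows "M = L_CoLT_mat N (diagonal N M) r"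
proof (rule eq_matI)
  fix i j
  assume "i < dim_row (L_CoLT_mat N (diagonal N M) r)" "j < dim_col (L_CoLT_mat N (diagonal N M) r)"
  then show "M $$ (i, j) = L_CoLT_mat N (diagonal N M) r $$ (i, j)"
    using assms(1) L_ratio_vector_entry[OF assms(2), of j i]
    by (auto simp: L_CoLT_def L_CoLT_mat_def diagonal_def)
qed (use assms(1) in \<open>auto simp: L_CoLT_def L_CoLT_mat_def\<close>)

lemma U_CoLT_eq_U_CoLT_mat:
  assumes "M \<in> U_CoLT N" "U_ratio_vector N M r"
  shows "M = U_CoLT_mat N (superdiagonal N M) r"
proof (rule eq_matI)
  fix i j
  assume "i < dim_row (U_CoLT_mat N (superdiagonal N M) r)"
    "j < dim_col (U_CoLT_mat N (superdiagonal N M) r)"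
  then show "M $$ (i, j) = U_CoLT_mat N (superdiagonal N M) r $$ (i, j)"
    using assms(1) U_ratio_vector_entry[OF assms(2), of i "j - 1"]
    \<comment> \<open>Column 0 lies wholly in the zero part; for a successor, \<open>j - 1\<close>
      is the true predecessor and the product formula applies above the diagonal.\<close>
    by (cases j) (auto simp: U_CoLT_def U_CoLT_mat_def superdiagonal_def)
qed (use assms(1) in \<open>auto simp: U_CoLT_def U_CoLT_mat_def\<close>)

theorem theorem3p2:
  fixes N :: nat
  shows "(\<forall>M\<^sub>L \<in> L_CoLT N. \<forall>r. L_ratio_vector N M\<^sub>L r \<longrightarrow>
            M\<^sub>L = L_CoLT_mat N (diagonal N M\<^sub>L) r) \<and>
         (\<forall>M\<^sub>U \<in> U_CoLT N. \<forall>r'. U_ratio_vector N M\<^sub>U r' \<longrightarrow>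
            M\<^sub>U = U_CoLT_mat N (superdiagonal N M\<^sub>U) r')"
  using L_CoLT_eq_L_CoLT_mat U_CoLT_eq_U_CoLT_mat by blast

end
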